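(* Let $n\ge1$. The logic $\mathsf{wGL}_n$ has uniform Lyndon interpolation: for every formula $\phi$ and all sets of propositional variables $V_+,V_-$ there is a formula $\iota$ such that (1) $\mathrm{Voc}_+(\iota)\subseteq V_+$ and $\mathrm{Voc}_-(\iota)\subseteq V_-$; (2) $\mathsf{wGL}_n\vdash\phi\to\iota$; (3) for every formula $\psi$ with $\mathrm{Voc}_+(\psi)\subseteq V_+$ and $\mathrm{Voc}_-(\psi)\subseteq V_-$, if $\mathsf{wGL}_n\vdash\phi\to\psi$ then $\mathsf{wGL}_n\vdash\iota\to\psi$.
   Context: Formulas are built from a countably infinite set $\mathrm{Var}$ of propositional variables by $\phi::=p\mid\bot\mid\phi\to\phi\mid\Box\phi$; $\Box^0\phi:=\phi$, $\Box^{m+1}\phi:=\Box\Box^m\phi$. $\mathsf{wGL}_n$ is the smallest set of formulas containing all classical propositional tautologies (in the modal language), all formulas $\Box(\phi\to\psi)\to(\Box\phi\to\Box\psi)$ and all formulas $\Box(\Box^n\phi\to\phi)\to\Box\phi$, and closed under modus ponens and necessitation (from $\phi$ infer $\Box\phi$). $\mathsf{wGL}_n\vdash\phi$ means $\phi\in\mathsf{wGL}_n$. The positive and negative vocabularies are defined by: $\mathrm{Voc}_+(p)=\{p\}$, $\mathrm{Voc}_-(p)=\varnothing$; $\mathrm{Voc}_\pm(\bot)=\varnothing$; $\mathrm{Voc}_+(\phi\to\psi)=\mathrm{Voc}_-(\phi)\cup\mathrm{Voc}_+(\psi)$; $\mathrm{Voc}_-(\phi\to\psi)=\mathrm{Voc}_+(\phi)\cup\mathrm{Voc}_-(\psi)$;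 $\mathrm{Voc}_\pm(\Box\phi)=\mathrm{Voc}_\pm(\phi)$. *)

theory Defs
  imports Main
begin

text \<open>The countably infinite set of propositional variables is the type \<^typ>\<open>nat\<close>.\<close>

type_synonym var = nat

datatype fm =
    Var var
  | Falsum  ("\<^bold>\<bottom>")
  | Imp fm fm  (infixr "\<^bold>\<rightarrow>" 55)
  | Box fm  ("\<^bold>\<box> _" [70] 70)

abbreviation box_pow :: "nat \<Rightarrow> fm \<Rightarrow> fm" where
  "box_pow m \<phi> \<equiv> (Box ^^ m) \<phi>"

text \<open>Classical truth-functional evaluation, in which variables and boxed formulas are both
  atoms, with truth values given by \<open>g\<close> and \<open>h\<close>. The formulas true under all such evaluations
  are exactly the substitution instances of propositional tautologies.\<close>

primrec truth :: "(var \<Rightarrow> bool) \<Rightarrow> (fm \<Rightarrow> bool) \<Rightarrow> fm \<Rightarrow> bool" where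
  "truth g h (Var p) \<longleftrightarrow> g p"
| "truth g h \<^bold>\<bottom> \<longleftrightarrow> False"
| "truth g h (\<phi> \<^bold>\<rightarrow> \<psi>) \<longleftrightarrow> (truth g h \<phi> \<longrightarrow> truth g h \<psi>)"
| "truth g h (\<^bold>\<box> \<phi>) \<longleftrightarrow> h \<phi>"

definition tautology :: "fm \<Rightarrow> bool" where
  "tautology \<phi> \<longleftrightarrow> (\<forall>g h. truth g h \<phi>)"

inductive_set wGL :: "nat \<Rightarrow> fm set" for n :: nat where
  taut: "tautology \<phi> \<Longrightarrow> \<phi> \<in> wGL n"
| K: "\<^bold>\<box> (\<phi> \<^bold>\<rightarrow> \<psi>) \<^bold>\<rightarrow> (\<^bold>\<box> \<phi> \<^bold>\<rightarrow> \<^bold>\<box> \<psi>) \<in> wGL n"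
| Loeb: "\<^bold>\<box> (box_pow n \<phi> \<^bold>\<rightarrow> \<phi>) \<^bold>\<rightarrow> \<^bold>\<box> \<phi> \<in> wGL n"
| MP: "\<phi> \<^bold>\<rightarrow> \<psi> \<in> wGL n \<Longrightarrow> \<phi> \<in> wGL n \<Longrightarrow> \<psi> \<in> wGL n"
| Nec: "\<phi> \<in> wGL n \<Longrightarrow> \<^bold>\<box> \<phi> \<in> wGL n"

abbreviation wGL_proves :: "nat \<Rightarrow> fm \<Rightarrow> bool"  ("wGL\<^bsub>_\<^esub> \<turnstile> _" [0, 51] 50) where
  "wGL\<^bsub>n\<^esub> \<turnstile> \<phi> \<equiv> \<phi> \<in> wGL n"

fun voc_pos :: "fm \<Rightarrow> var set" and voc_neg :: "fm \<Rightarrow> var set" where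
  "voc_pos (Var p) = {p}"
| "voc_pos \<^bold>\<bottom> = {}"
| "voc_pos (\<phi> \<^bold>\<rightarrow> \<psi>) = voc_neg \<phi> \<union> voc_pos \<psi>"
| "voc_pos (\<^bold>\<box> \<phi>) = voc_pos \<phi>"
| "voc_neg (Var p) = {}"
| "voc_neg \<^bold>\<bottom> = {}"
| "voc_neg (\<phi> \<^bold>\<rightarrow> \<psi>) = voc_pos \<phi> \<union> voc_neg \<psi>"
| "voc_neg (\<^bold>\<box> \<phi>) = voc_neg \<phi>"

end

theory Submission
  imports Defs
begin

text \<open>The logic is complete for conversely well-founded frames in which \<open>n + 1\<close> steps can be
  replaced by one (\<open>soundness\<close>, \<open>completeness\<close>), so everything can be decided on models.

  Which worlds \<open>y\<close> of a model \<open>N\<close> should satisfy the interpolant? Those for which some model of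
  \<open>\<phi>\<close> can be simulated by \<open>N\<close> at \<open>y\<close>: every variable of \<open>V_pos\<close> true on the left is true on the
  right, every variable of \<open>V_neg\<close> true on the right is true on the left, and successors can be
  matched in both directions. Such a simulation can be searched for in a finite space. A
  world on the left matters only through its type, which records the variables of \<open>\<phi>\<close> true there
  and, for each subformula \<open>\<box>\<psi>\<close>, which of \<open>\<box>\<psi>, \<dots>, \<box>\<^sup>n \<psi>\<close> are true there. The resulting relation
  \<open>sim\<close> between types and worlds of \<open>N\<close> is given by recursion along the well-founded \<open>N\<close>. Conversely, the pairs
  in \<open>sim\<close> themselves form a model which realises the types (\<open>type_model_truth\<close>) and is simulated
  by \<open>N\<close> (\<open>type_model_preserves\<close>). Hence, if \<open>\<iota>\<close> defines the worlds related to a type containing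
  \<open>\<phi>\<close>, then \<open>\<phi> \<rightarrow> \<iota>\<close> is valid because every model is related to its own types (\<open>sim_type_of\<close>), and a
  countermodel to \<open>\<iota> \<rightarrow> \<psi>\<close> yields one to \<open>\<phi> \<rightarrow> \<psi>\<close>.

  It remains to define \<open>sim\<close> by modal formulas that respect \<open>V_pos\<close> and \<open>V_neg\<close>
  (\<open>definable_sim\<close>), which is a fixed point problem. Along a step the index \<open>j\<close> of \<open>\<box>\<^sup>j \<psi>\<close> drops by one,
  and \<open>\<box>\<psi>\<close> turns into \<open>\<box>\<^sup>n \<psi>\<close>, because \<open>\<box>\<psi> \<rightarrow> \<box>\<^sup>n\<^sup>+\<^sup>1 \<psi>\<close> is provable. So the set of true
  \<open>\<box>\<^sup>j \<psi>\<close> is shifted cyclically with period \<open>n\<close> and can only grow. A step that refutes some \<open>\<psi>\<close>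
  with \<open>\<box>\<psi>\<close> false makes it grow strictly, since there the successor can be chosen to satisfy
  \<open>\<box>\<^sup>n \<psi>\<close>. Induction on the size of this set therefore leaves only one cyclic system of \<open>n\<close>
  equations of the form \<open>Y\<^sub>i = \<box>(E\<^sub>i \<or> D\<^sub>i \<and> Y\<^sub>i\<^sub>+\<^sub>1)\<close>, with \<open>E\<^sub>i\<close> and \<open>D\<^sub>i\<close> already defined. Unwinding
  it \<open>n\<close> times from truth gives the solution: a world \<open>n + 1\<close> steps away is also one step away, so
  the next unwinding demands nothing new (\<open>unwind_fixed_point\<close>).\<close>

section \<open>Kripke semantics\<close>

primrec sat :: "('w \<Rightarrow> 'w \<Rightarrow> bool) \<Rightarrow> ('w \<Rightarrow> var \<Rightarrow> bool) \<Rightarrow> 'w \<Rightarrow> fm \<Rightarrow> bool" where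
  "sat R V w (Var p) \<longleftrightarrow> V w p"
| "sat R V w \<^bold>\<bottom> \<longleftrightarrow> False"
| "sat R V w (\<phi> \<^bold>\<rightarrow> \<psi>) \<longleftrightarrow> (sat R V w \<phi> \<longrightarrow> sat R V w \<psi>)"
| "sat R V w (\<^bold>\<box> \<phi>) \<longleftrightarrow> (\<forall>w'. R w w' \<longrightarrow> sat R V w' \<phi>)"

definition wGL_frame :: "nat \<Rightarrow> ('w \<Rightarrow> 'w \<Rightarrow> bool) \<Rightarrow> bool" where
  "wGL_frame n R \<longleftrightarrow> wfP (R\<inverse>\<inverse>) \<and> (\<forall>x y. (R ^^ Suc n) x y \<longrightarrow> R x y)"

lemma wGL_frame_induct [consumes 1, case_names step]:
  assumes "wGL_frame n R" and "\<And>x. (\<And>y. R x y \<Longrightarrow> P y) \<Longrightarrow> P x"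
  shows "P x"
proof -
  have "wfP (R\<inverse>\<inverse>)" using assms(1) by (simp add: wGL_frame_def)
  then show ?thesis
    by (induction x rule: wfp_induct_rule) (auto intro: assms(2))
qed

lemma wGL_frame_shortcut:
  assumes "wGL_frame n R" "R x y" "(R ^^ n) y z"
  shows "R x z"
  using assms relpowp_Suc_I2[of R x y n z] by (auto simp: wGL_frame_def)

lemma sat_box_pow: "sat R V w (box_pow m \<phi>) \<longleftrightarrow> (\<forall>y. (R ^^ m) w y \<longrightarrow> sat R V y \<phi>)"
proof (induction m arbitrary: w)
  case (Suc m)
  show ?case
    by (auto simp: Suc.IH intro: relpowp_Suc_I2 elim: relpowp_Suc_E2 simp del: relpowp.simps)
qed simp

text \<open>Take a successor of \<open>x\<close> refuting \<open>\<phi>\<close> after which no other such successor comes. What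
  lies \<open>n\<close> steps beyond it is again a successor of \<open>x\<close>, hence satisfies \<open>\<phi>\<close>.\<close>

lemma Loeb_witness:
  assumes fr: "wGL_frame n R" and n: "n \<ge> 1"
    and "\<not> sat R V x (\<^bold>\<box> \<phi>)"
  shows "\<exists>y. R x y \<and> sat R V y (box_pow n \<phi>) \<and> \<not> sat R V y \<phi>"
proof (rule ccontr)
  assume none: "\<not> ?thesis"
  have *: "R x y \<longrightarrow> sat R V y \<phi>" for y
  proof -
    have "wfP ((R\<inverse>\<inverse>)\<^sup>+\<^sup>+)" using fr by (simp add: wGL_frame_def wfp_tranclp)
    then show ?thesis
    proof (induction y rule: wfp_induct_rule)
      case (less y)
      show ?case
      proof
        assume xy: "R x y"
        have "sat R V z \<phi>" if "(R ^^ n) y z" for z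
        proof -
          have "R\<^sup>+\<^sup>+ y z" using that n unfolding tranclp_power by (intro exI[of _ n]) simp
          then have "(R\<inverse>\<inverse>)\<^sup>+\<^sup>+ z y" by (simp add: tranclp_converse)
          then show ?thesis using less wGL_frame_shortcut[OF fr xy that] by blast
        qed
        then have "sat R V y (box_pow n \<phi>)" by (simp add: sat_box_pow)
        then show "sat R V y \<phi>" using none xy by blast
      qed
    qed
  qed
  then show False using assms(3) by simp
qed

lemma sat_eq_truth: "sat R V w \<phi> \<longleftrightarrow> truth (V w) (\<lambda>\<psi>. sat R V w (\<^bold>\<box> \<psi>)) \<phi>"
  by (induction \<phi>) auto

lemma soundness:
  assumes "wGL\<^bsub>n\<^esub> \<turnstile> \<phi>" "wGL_frame n R" "n \<ge> 1"
  shows "sat R V w \<phi>"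
  using assms(1)
proof (induction arbitrary: w)
  case (taut \<phi>)
  then show ?case using sat_eq_truth[of R V w \<phi>] by (simp add: tautology_def)
next
  case (Loeb \<phi>)
  then show ?case using Loeb_witness[OF assms(2,3), of V w \<phi>] by auto
qed auto

section \<open>Derivability and maximal consistent sets\<close>

abbreviation Imps :: "fm list \<Rightarrow> fm \<Rightarrow> fm" where
  "Imps L \<chi> \<equiv> foldr Imp L \<chi>"

lemma truth_Imps: "truth g h (Imps L \<chi>) \<longleftrightarrow> ((\<forall>x\<in>set L. truth g h x) \<longrightarrow> truth g h \<chi>)"
  by (induction L) auto

lemma wGL_tautological_consequence:
  assumes "\<And>g h. (\<forall>x\<in>set L. truth g h x) \<Longrightarrow> truth g h \<chi>" and "set L \<subseteq> wGL n"
  shows "wGL\<^bsub>n\<^esub> \<turnstile> \<chi>"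
proof -
  have mp: "wGL\<^bsub>n\<^esub> \<turnstile> Imps L \<chi> \<Longrightarrow> set L \<subseteq> wGL n \<Longrightarrow> wGL\<^bsub>n\<^esub> \<turnstile> \<chi>"
    by (induction L) (auto intro: wGL.MP)
  have "wGL\<^bsub>n\<^esub> \<turnstile> Imps L \<chi>"
    using assms(1) by (intro wGL.taut) (simp add: tautology_def truth_Imps)
  then show ?thesis using mp assms(2) by blast
qed

lemma wGL_box_mono:
  assumes "wGL\<^bsub>n\<^esub> \<turnstile> a \<^bold>\<rightarrow> b"
  shows "wGL\<^bsub>n\<^esub> \<turnstile> \<^bold>\<box> a \<^bold>\<rightarrow> \<^bold>\<box> b"
  using wGL.MP[OF wGL.K wGL.Nec[OF assms]] .

lemma wGL_box_pow_mono:
  "wGL\<^bsub>n\<^esub> \<turnstile> a \<^bold>\<rightarrow> b \<Longrightarrow> wGL\<^bsub>n\<^esub> \<turnstile> box_pow m a \<^bold>\<rightarrow> box_pow m b"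
  by (induction m) (auto intro: wGL_box_mono)

text \<open>Loeb's axiom for the conjunction \<open>\<psi>\<close> of \<open>\<phi>\<close> and \<open>\<box>\<^sup>n \<phi>\<close>: for this \<open>\<psi>\<close> the formula \<open>\<phi>\<close>
  alone implies \<open>\<box>\<^sup>n \<psi> \<rightarrow> \<psi>\<close>.\<close>

lemma wGL_transitivity: "wGL\<^bsub>n\<^esub> \<turnstile> \<^bold>\<box> \<phi> \<^bold>\<rightarrow> box_pow (Suc n) \<phi>"
proof -
  define \<psi> where "\<psi> = ((\<phi> \<^bold>\<rightarrow> (box_pow n \<phi> \<^bold>\<rightarrow> \<^bold>\<bottom>)) \<^bold>\<rightarrow> \<^bold>\<bottom>)"
  have 1: "wGL\<^bsub>n\<^esub> \<turnstile> \<psi> \<^bold>\<rightarrow> \<phi>" "wGL\<^bsub>n\<^esub> \<turnstile> \<psi> \<^bold>\<rightarrow> box_pow n \<phi>"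
    unfolding \<psi>_def by (rule wGL.taut; simp add: tautology_def)+
  have "wGL\<^bsub>n\<^esub> \<turnstile> box_pow n \<psi> \<^bold>\<rightarrow> box_pow n \<phi>" by (rule wGL_box_pow_mono[OF 1(1)])
  then have "wGL\<^bsub>n\<^esub> \<turnstile> \<phi> \<^bold>\<rightarrow> (box_pow n \<psi> \<^bold>\<rightarrow> \<psi>)"
    by (intro wGL_tautological_consequence[of "[box_pow n \<psi> \<^bold>\<rightarrow> box_pow n \<phi>]"])
       (auto simp: \<psi>_def)
  then have 2: "wGL\<^bsub>n\<^esub> \<turnstile> \<^bold>\<box> \<phi> \<^bold>\<rightarrow> \<^bold>\<box> (box_pow n \<psi> \<^bold>\<rightarrow> \<psi>)" by (rule wGL_box_mono)
  have 3: "wGL\<^bsub>n\<^esub> \<turnstile> \<^bold>\<box> \<psi> \<^bold>\<rightarrow> \<^bold>\<box> (box_pow n \<phi>)" by (rule wGL_box_mono[OF 1(2)])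
  show ?thesis
    by (rule wGL_tautological_consequence
        [of "[\<^bold>\<box> \<phi> \<^bold>\<rightarrow> \<^bold>\<box> (box_pow n \<psi> \<^bold>\<rightarrow> \<psi>), \<^bold>\<box> (box_pow n \<psi> \<^bold>\<rightarrow> \<psi>) \<^bold>\<rightarrow> \<^bold>\<box> \<psi>,
              \<^bold>\<box> \<psi> \<^bold>\<rightarrow> \<^bold>\<box> (box_pow n \<phi>)]"]) (use 2 3 wGL.Loeb in auto)
qed

definition derives :: "nat \<Rightarrow> fm set \<Rightarrow> fm \<Rightarrow> bool" where
  "derives n \<Gamma> \<chi> \<longleftrightarrow> (\<exists>L. set L \<subseteq> \<Gamma> \<and> wGL\<^bsub>n\<^esub> \<turnstile> Imps L \<chi>)"

lemma derives_member: "\<chi> \<in> \<Gamma> \<Longrightarrow> derives n \<Gamma> \<chi>"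
  unfolding derives_def
  by (rule exI[of _ "[\<chi>]"]) (auto intro!: wGL.taut simp: tautology_def)

lemma derives_theorem: "wGL\<^bsub>n\<^esub> \<turnstile> \<chi> \<Longrightarrow> derives n \<Gamma> \<chi>"
  unfolding derives_def by (rule exI[of _ "[]"]) auto

lemma derives_tautological_consequence:
  assumes "derives n \<Gamma> a" "derives n \<Gamma> b"
    and "\<And>g h. truth g h a \<Longrightarrow> truth g h b \<Longrightarrow> truth g h \<chi>"
  shows "derives n \<Gamma> \<chi>"
proof -
  obtain L M where LM: "set L \<subseteq> \<Gamma>" "wGL\<^bsub>n\<^esub> \<turnstile> Imps L a" "set M \<subseteq> \<Gamma>" "wGL\<^bsub>n\<^esub> \<turnstile> Imps M b"
    using assms by (auto simp: derives_def)
  have "wGL\<^bsub>n\<^esub> \<turnstile> Imps (L @ M) \<chi>"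
  proof (rule wGL_tautological_consequence[of "[Imps L a, Imps M b]"])
    show "truth g h (Imps (L @ M) \<chi>)" if "\<forall>x\<in>set [Imps L a, Imps M b]. truth g h x" for g h
      using that assms(3)[of g h] unfolding truth_Imps by (simp add: truth_Imps ball_Un)
  qed (use LM in auto)
  moreover have "set (L @ M) \<subseteq> \<Gamma>" using LM by auto
  ultimately show ?thesis unfolding derives_def by blast
qed

lemma derives_insert:
  assumes "derives n (insert a \<Gamma>) \<chi>"
  shows "derives n \<Gamma> (a \<^bold>\<rightarrow> \<chi>)"
proof -
  obtain L where L: "set L \<subseteq> insert a \<Gamma>" "wGL\<^bsub>n\<^esub> \<turnstile> Imps L \<chi>"
    using assms by (auto simp: derives_def)
  let ?L = "filter (\<lambda>x. x \<noteq> a) L"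
  have "wGL\<^bsub>n\<^esub> \<turnstile> Imps ?L (a \<^bold>\<rightarrow> \<chi>)"
  proof (rule wGL_tautological_consequence[of "[Imps L \<chi>]"])
    show "truth g h (Imps ?L (a \<^bold>\<rightarrow> \<chi>))" if "\<forall>x\<in>set [Imps L \<chi>]. truth g h x" for g h
      using that by (auto simp: truth_Imps)
  qed (use L in auto)
  moreover have "set ?L \<subseteq> \<Gamma>" using L by auto
  ultimately show ?thesis unfolding derives_def by blast
qed

lemma derives_box:
  assumes "derives n {\<chi>. \<^bold>\<box> \<chi> \<in> \<Gamma>} \<psi>"
  shows "derives n \<Gamma> (\<^bold>\<box> \<psi>)"
proof -
  have dist: "wGL\<^bsub>n\<^esub> \<turnstile> \<^bold>\<box> (Imps L \<psi>) \<^bold>\<rightarrow> Imps (map Box L) (\<^bold>\<box> \<psi>)" for L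
  proof (induction L)
    case Nil
    show ?case by (auto intro!: wGL.taut simp: tautology_def)
  next
    case (Cons a L)
    show ?case
      by (rule wGL_tautological_consequence
          [of "[\<^bold>\<box> (a \<^bold>\<rightarrow> Imps L \<psi>) \<^bold>\<rightarrow> (\<^bold>\<box> a \<^bold>\<rightarrow> \<^bold>\<box> (Imps L \<psi>)),
                \<^bold>\<box> (Imps L \<psi>) \<^bold>\<rightarrow> Imps (map Box L) (\<^bold>\<box> \<psi>)]"])
         (use Cons.IH wGL.K in auto)
  qed
  obtain L where L: "set L \<subseteq> {\<chi>. \<^bold>\<box> \<chi> \<in> \<Gamma>}" "wGL\<^bsub>n\<^esub> \<turnstile> Imps L \<psi>"
    using assms by (auto simp: derives_def)
  then have "wGL\<^bsub>n\<^esub> \<turnstile> Imps (map Box L) (\<^bold>\<box> \<psi>)" using wGL.MP[OF dist wGL.Nec] by blast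
  moreover have "set (map Box L) \<subseteq> \<Gamma>" using L(1) by auto
  ultimately show ?thesis unfolding derives_def by blast
qed

definition mcs :: "nat \<Rightarrow> fm set \<Rightarrow> bool" where
  "mcs n \<Gamma> \<longleftrightarrow> \<not> derives n \<Gamma> \<^bold>\<bottom> \<and> (\<forall>a. a \<in> \<Gamma> \<or> (a \<^bold>\<rightarrow> \<^bold>\<bottom>) \<in> \<Gamma>)"

lemma mcs_derives_iff: "mcs n \<Gamma> \<Longrightarrow> derives n \<Gamma> a \<longleftrightarrow> a \<in> \<Gamma>"
  using derives_tautological_consequence[of n \<Gamma> a "a \<^bold>\<rightarrow> \<^bold>\<bottom>" "\<^bold>\<bottom>"]
  by (auto simp: mcs_def intro: derives_member)

lemma mcs_Falsum: "mcs n \<Gamma> \<Longrightarrow> \<^bold>\<bottom> \<notin> \<Gamma>"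
  by (auto simp: mcs_def intro: derives_member)

lemma mcs_Imp: "mcs n \<Gamma> \<Longrightarrow> (a \<^bold>\<rightarrow> b) \<in> \<Gamma> \<longleftrightarrow> (a \<in> \<Gamma> \<longrightarrow> b \<in> \<Gamma>)"
proof -
  assume m: "mcs n \<Gamma>"
  have "a \<in> \<Gamma> \<or> (a \<^bold>\<rightarrow> \<^bold>\<bottom>) \<in> \<Gamma>" using m by (auto simp: mcs_def)
  moreover have "(a \<^bold>\<rightarrow> b) \<in> \<Gamma> \<Longrightarrow> a \<in> \<Gamma> \<Longrightarrow> b \<in> \<Gamma>"
    using derives_tautological_consequence[of n \<Gamma> a "a \<^bold>\<rightarrow> b" b] mcs_derives_iff[OF m] by auto
  moreover have "b \<in> \<Gamma> \<Longrightarrow> (a \<^bold>\<rightarrow> b) \<in> \<Gamma>"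
    using derives_tautological_consequence[of n \<Gamma> b b "a \<^bold>\<rightarrow> b"] mcs_derives_iff[OF m] by auto
  moreover have "(a \<^bold>\<rightarrow> \<^bold>\<bottom>) \<in> \<Gamma> \<Longrightarrow> (a \<^bold>\<rightarrow> b) \<in> \<Gamma>"
    using derives_tautological_consequence[of n \<Gamma> "a \<^bold>\<rightarrow> \<^bold>\<bottom>" "a \<^bold>\<rightarrow> \<^bold>\<bottom>" "a \<^bold>\<rightarrow> b"] mcs_derives_iff[OF m] by auto
  ultimately show ?thesis by blast
qed

lemma mcs_theorem_Imp: "mcs n \<Gamma> \<Longrightarrow> wGL\<^bsub>n\<^esub> \<turnstile> a \<^bold>\<rightarrow> b \<Longrightarrow> a \<in> \<Gamma> \<Longrightarrow> b \<in> \<Gamma>"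
  using derives_theorem[of "a \<^bold>\<rightarrow> b" n \<Gamma>] mcs_derives_iff mcs_Imp by blast

lemma mcs_extension:
  assumes cons: "\<not> derives n \<Gamma> \<^bold>\<bottom>"
  shows "\<exists>\<Delta>. \<Gamma> \<subseteq> \<Delta> \<and> mcs n \<Delta>"
proof -
  define \<A> where "\<A> = {\<Delta>. \<Gamma> \<subseteq> \<Delta> \<and> \<not> derives n \<Delta> \<^bold>\<bottom>}"
  have "\<Union>\<C> \<in> \<A>" if ch: "\<C> \<noteq> {}" "subset.chain \<A> \<C>" for \<C>
  proof -
    have sub: "\<C> \<subseteq> \<A>" using ch by (auto simp: subset.chain_def)
    have "\<not> derives n (\<Union>\<C>) \<^bold>\<bottom>"
    proof
      assume "derives n (\<Union>\<C>) \<^bold>\<bottom>"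
      then obtain L where L: "set L \<subseteq> \<Union>\<C>" "wGL\<^bsub>n\<^esub> \<turnstile> Imps L \<^bold>\<bottom>" by (auto simp: derives_def)
      obtain \<Delta> where "\<Delta> \<in> \<C>" "set L \<subseteq> \<Delta>"
        using finite_subset_Union_chain[OF _ L(1) ch] by auto
      then show False using L(2) sub by (auto simp: \<A>_def derives_def)
    qed
    then show ?thesis using sub ch(1) by (auto simp: \<A>_def)
  qed
  moreover have "\<A> \<noteq> {}" using cons by (auto simp: \<A>_def)
  ultimately obtain \<Delta> where \<Delta>: "\<Delta> \<in> \<A>" "\<forall>X\<in>\<A>. \<Delta> \<subseteq> X \<longrightarrow> X = \<Delta>"
    using subset_Zorn_nonempty[of \<A>] by blast
  have "a \<in> \<Delta> \<or> (a \<^bold>\<rightarrow> \<^bold>\<bottom>) \<in> \<Delta>" for a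
  proof (rule ccontr)
    assume *: "\<not> ?thesis"
    have "derives n \<Delta> (b \<^bold>\<rightarrow> \<^bold>\<bottom>)" if "b \<notin> \<Delta>" for b
    proof (rule derives_insert)
      have "insert b \<Delta> \<notin> \<A>" using that \<Delta> by blast
      then show "derives n (insert b \<Delta>) \<^bold>\<bottom>" using \<Delta>(1) by (auto simp: \<A>_def)
    qed
    then have "derives n \<Delta> (a \<^bold>\<rightarrow> \<^bold>\<bottom>)" "derives n \<Delta> ((a \<^bold>\<rightarrow> \<^bold>\<bottom>) \<^bold>\<rightarrow> \<^bold>\<bottom>)" using * by auto
    then have "derives n \<Delta> \<^bold>\<bottom>" by (rule derives_tautological_consequence) auto
    then show False using \<Delta>(1) by (simp add: \<A>_def)
  qed
  then show ?thesis using \<Delta>(1) by (auto simp: mcs_def \<A>_def)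
qed

text \<open>If no such \<open>\<Delta>\<close> existed, the formulas boxed in \<open>\<Gamma>\<close> would derive \<open>\<box>\<^sup>n \<psi> \<rightarrow> \<psi>\<close>; boxing
  the derivation and applying Loeb's axiom would put \<open>\<box>\<psi>\<close> into \<open>\<Gamma>\<close>.\<close>

lemma mcs_Loeb_successor:
  assumes m: "mcs n \<Gamma>" and "\<^bold>\<box> \<psi> \<notin> \<Gamma>"
  shows "\<exists>\<Delta>. mcs n \<Delta> \<and> {\<chi>. \<^bold>\<box> \<chi> \<in> \<Gamma>} \<subseteq> \<Delta> \<and> box_pow n \<psi> \<in> \<Delta> \<and> \<psi> \<notin> \<Delta>"
proof -
  let ?D = "{\<chi>. \<^bold>\<box> \<chi> \<in> \<Gamma>}"
  have "\<not> derives n (insert (\<psi> \<^bold>\<rightarrow> \<^bold>\<bottom>) (insert (box_pow n \<psi>) ?D)) \<^bold>\<bottom>"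
  proof
    assume "derives n (insert (\<psi> \<^bold>\<rightarrow> \<^bold>\<bottom>) (insert (box_pow n \<psi>) ?D)) \<^bold>\<bottom>"
    then have *: "derives n ?D (box_pow n \<psi> \<^bold>\<rightarrow> ((\<psi> \<^bold>\<rightarrow> \<^bold>\<bottom>) \<^bold>\<rightarrow> \<^bold>\<bottom>))"
      by (intro derives_insert)
    have "derives n ?D (box_pow n \<psi> \<^bold>\<rightarrow> \<psi>)"
      by (rule derives_tautological_consequence[OF * *]) auto
    then have "derives n \<Gamma> (\<^bold>\<box> (box_pow n \<psi> \<^bold>\<rightarrow> \<psi>))" by (rule derives_box)
    then show False using mcs_theorem_Imp[OF m wGL.Loeb] mcs_derives_iff[OF m] assms(2) by blast
  qed
  then obtain \<Delta> where \<Delta>: "insert (\<psi> \<^bold>\<rightarrow> \<^bold>\<bottom>) (insert (box_pow n \<psi>) ?D) \<subseteq> \<Delta>" "mcs n \<Delta>"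
    using mcs_extension by blast
  then have "\<psi> \<notin> \<Delta>" using mcs_Imp[OF \<Delta>(2), of \<psi> "\<^bold>\<bottom>"] mcs_Falsum[OF \<Delta>(2)] by simp
  then show ?thesis using \<Delta> by auto
qed

section \<open>Cyclic profiles of boxed formulas\<close>

primrec boxed :: "fm \<Rightarrow> fm set" where
  "boxed (Var p) = {}"
| "boxed \<^bold>\<bottom> = {}"
| "boxed (\<phi> \<^bold>\<rightarrow> \<psi>) = boxed \<phi> \<union> boxed \<psi>"
| "boxed (\<^bold>\<box> \<phi>) = insert \<phi> (boxed \<phi>)"

lemma finite_boxed: "finite (boxed \<phi>)"
  by (induction \<phi>) auto

lemma boxed_closed:
  "\<psi> \<in> boxed \<phi> \<Longrightarrow> boxed \<psi> \<subseteq> boxed \<phi> \<and> voc_pos \<psi> \<union> voc_neg \<psi> \<subseteq> voc_pos \<phi> \<union> voc_neg \<phi>"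
  by (induction \<phi>) auto

text \<open>The slot \<open>(\<psi>, j)\<close> stands for \<open>\<box>\<^sup>j\<^sup>+\<^sup>1 \<psi>\<close>. Counting from zero makes the move from \<open>\<box>\<psi>\<close> to
  \<open>\<box>\<^sup>n \<psi>\<close> the wrap-around of the indices modulo \<open>n\<close>.\<close>

definition profile :: "nat \<Rightarrow> fm set \<Rightarrow> (fm \<Rightarrow> bool) \<Rightarrow> (fm \<times> nat) set" where
  "profile n B X = {(\<psi>, j). \<psi> \<in> B \<and> j < n \<and> X (box_pow (Suc j) \<psi>)}"

definition shift :: "nat \<Rightarrow> (fm \<times> nat) set \<Rightarrow> (fm \<times> nat) set" where
  "shift n b = {(\<psi>, j). j < n \<and> (\<psi>, Suc j mod n) \<in> b}"

lemma profile_subset: "profile n B X \<subseteq> B \<times> {..<n}"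
  by (auto simp: profile_def)

lemma shift_subset: "n \<ge> 1 \<Longrightarrow> b \<subseteq> B \<times> {..<n} \<Longrightarrow> shift n b \<subseteq> B \<times> {..<n}"
  by (auto simp: shift_def)

lemma shift_mono: "b \<subseteq> b' \<Longrightarrow> shift n b \<subseteq> shift n b'"
  by (auto simp: shift_def)

lemma shift_funpow:
  assumes "b \<subseteq> B \<times> {..<n}"
  shows "(shift n ^^ k) b = {(\<psi>, j). j < n \<and> (\<psi>, (j + k) mod n) \<in> b}"
proof (induction k)
  case 0
  then show ?case using assms by auto
next
  case (Suc k)
  have "(shift n ^^ Suc k) b = shift n {(\<psi>, j). j < n \<and> (\<psi>, (j + k) mod n) \<in> b}"
    using Suc by simp
  also have "\<dots> = {(\<psi>, j). j < n \<and> (\<psi>, (j + Suc k) mod n) \<in> b}"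
    by (auto simp: shift_def mod_simps)
  finally show ?case .
qed

lemma shift_funpow_period: "b \<subseteq> B \<times> {..<n} \<Longrightarrow> (shift n ^^ n) b = b"
  by (auto simp: shift_funpow)

lemma card_shift_le:
  assumes "b \<subseteq> B \<times> {..<n}" "finite B"
  shows "card (shift n b) \<le> card b"
proof (rule card_inj_on_le)
  show "finite b" using assms finite_subset by blast
  show "(\<lambda>(\<psi>, j). (\<psi>, Suc j mod n)) ` shift n b \<subseteq> b" by (auto simp: shift_def)
  show "inj_on (\<lambda>(\<psi>, j). (\<psi>, Suc j mod n)) (shift n b)"
    by (auto simp: inj_on_def shift_def mod_Suc split: if_splits)
qed

text \<open>A single shift does not enlarge a profile, and \<open>n\<close> of them restore it, so none of them can
  shrink it.\<close>

lemma card_shift: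
  assumes n: "n \<ge> 1" and b: "b \<subseteq> B \<times> {..<n}" and fin: "finite B"
  shows "card (shift n b) = card b"
proof (rule antisym[OF card_shift_le[OF b fin]])
  have sub: "(shift n ^^ k) b \<subseteq> B \<times> {..<n}" for k
    by (induction k) (use b shift_subset[OF n] in auto)
  have le: "card ((shift n ^^ Suc k) b) \<le> card (shift n b)" for k
  proof (induction k)
    case (Suc k)
    have "card ((shift n ^^ Suc (Suc k)) b) \<le> card ((shift n ^^ Suc k) b)"
      using card_shift_le[OF sub fin, of "Suc k"] by simp
    then show ?case using Suc by linarith
  qed simp
  have "Suc (n - 1) = n" using n by simp
  then show "card b \<le> card (shift n b)"
    using le[of "n - 1"] shift_funpow_period[OF b] by simp
qed

lemma profile_successor:
  assumes "\<And>\<chi>. X (\<^bold>\<box> \<chi>) \<Longrightarrow> Y \<chi>" "\<And>\<chi>. X (\<^bold>\<box> \<chi>) \<Longrightarrow> Y (box_pow n \<chi>)"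
  shows "shift n (profile n B X) \<subseteq> profile n B Y"
proof (clarsimp simp: shift_def profile_def)
  fix \<psi> j
  assume "j < n" "X (\<^bold>\<box> (box_pow (Suc j mod n) \<psi>))"
  then show "Y (\<^bold>\<box> (box_pow j \<psi>))"
    using assms by (cases "Suc j = n") auto
qed

text \<open>When \<open>\<box>\<psi>\<close> fails and a successor satisfies \<open>\<box>\<^sup>n \<psi>\<close>, the last slot of \<open>\<psi>\<close> in the profile of
  the successor is new.\<close>

lemma card_profile_less:
  assumes n: "n \<ge> 1" and b: "b \<subseteq> B \<times> {..<n}" "b' \<subseteq> B \<times> {..<n}" "finite B"
    and "shift n b \<subseteq> b'" "(\<psi>, 0) \<notin> b" "(\<psi>, n - 1) \<in> b'"
  shows "card b < card b'"
proof -
  have "(\<psi>, n - 1) \<notin> shift n b" using assms by (auto simp: shift_def)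
  then have "shift n b \<subset> b'" using assms by blast
  moreover have "finite b'" using b finite_subset by blast
  ultimately show ?thesis using psubset_card_mono card_shift[OF n b(1,3)] by metis
qed

section \<open>Completeness\<close>

lemma wGL_frame_rankI:
  fixes rk :: "'w \<Rightarrow> nat"
  assumes "\<And>x y. R x y \<Longrightarrow> rk x < rk y" "\<And>x. rk x \<le> N"
    and "\<And>x y. (R ^^ Suc n) x y \<Longrightarrow> R x y"
  shows "wGL_frame n R"
proof -
  have "wfP (R\<inverse>\<inverse>)"
  proof (rule wfp_if_convertible_to_nat[where f = "\<lambda>x. N - rk x"])
    show "\<And>x y. R\<inverse>\<inverse> x y \<Longrightarrow> N - rk x < N - rk y"
      using assms(1,2) by (metis conversep_iff diff_less_mono2 order_less_le_trans)
  qed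
  then show ?thesis using assms(3) by (simp add: wGL_frame_def)
qed

text \<open>The canonical relation between maximal consistent sets is restricted to pairs along which
  the profile of \<open>\<chi>\<close> grows. This makes it conversely well-founded, and it keeps enough successors:
  a box of \<open>\<chi>\<close> that fails is refuted at a Loeb successor, where the profile does grow.\<close>

theorem completeness:
  assumes n: "n \<ge> 1" and unprovable: "\<not> wGL\<^bsub>n\<^esub> \<turnstile> \<chi>"
  shows "\<exists>(R :: fm set \<Rightarrow> fm set \<Rightarrow> bool) V w. wGL_frame n R \<and> \<not> sat R V w \<chi>"
proof -
  let ?B = "boxed \<chi>"
  define pr where "pr \<Gamma> = profile n ?B (\<lambda>\<psi>. \<psi> \<in> \<Gamma>)" for \<Gamma>
  define R where "R \<Gamma> \<Delta> \<longleftrightarrow> mcs n \<Gamma> \<and> mcs n \<Delta> \<and> {\<chi>. \<^bold>\<box> \<chi> \<in> \<Gamma>} \<subseteq> \<Delta> \<and> card (pr \<Gamma>) < card (pr \<Delta>)"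
    for \<Gamma> \<Delta>
  define V where "V \<Gamma> p \<longleftrightarrow> Var p \<in> \<Gamma>" for \<Gamma> p
  have fin: "finite (?B \<times> {..<n})" by (simp add: finite_boxed)
  have pow: "mcs n \<Gamma> \<and> mcs n \<Delta> \<and> {\<chi>. box_pow (Suc k) \<chi> \<in> \<Gamma>} \<subseteq> \<Delta> \<and> card (pr \<Gamma>) < card (pr \<Delta>)"
    if "(R ^^ Suc k) \<Gamma> \<Delta>" for k \<Gamma> \<Delta>
    using that
  proof (induction k arbitrary: \<Gamma>)
    case 0
    then show ?case by (auto simp: R_def)
  next
    case (Suc k)
    then obtain \<Theta> where \<Theta>: "R \<Gamma> \<Theta>" "(R ^^ Suc k) \<Theta> \<Delta>" by (meson relpowp_Suc_D2)
    show ?case using Suc.IH[OF \<Theta>(2)] \<Theta>(1) by (auto simp: R_def)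
  qed
  have fr: "wGL_frame n R"
  proof (rule wGL_frame_rankI)
    show "card (pr \<Gamma>) < card (pr \<Delta>)" if "R \<Gamma> \<Delta>" for \<Gamma> \<Delta> using that by (simp add: R_def)
    show "card (pr \<Gamma>) \<le> card (?B \<times> {..<n})" for \<Gamma>
      unfolding pr_def by (rule card_mono[OF fin profile_subset])
    show "R \<Gamma> \<Delta>" if "(R ^^ Suc n) \<Gamma> \<Delta>" for \<Gamma> \<Delta>
      using pow[OF that] mcs_theorem_Imp[OF _ wGL_transitivity, of n \<Gamma>] by (auto simp: R_def)
  qed
  have truth_lemma: "sat R V \<Gamma> \<theta> \<longleftrightarrow> \<theta> \<in> \<Gamma>" if "mcs n \<Gamma>" "boxed \<theta> \<subseteq> ?B" for \<Gamma> \<theta>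
    using that
  proof (induction \<theta> arbitrary: \<Gamma>)
    case (Box \<psi>)
    show ?case
    proof (cases "\<^bold>\<box> \<psi> \<in> \<Gamma>")
      case True
      then show ?thesis using Box by (auto simp: R_def)
    next
      case False
      then obtain \<Delta> where \<Delta>: "mcs n \<Delta>" "{\<chi>. \<^bold>\<box> \<chi> \<in> \<Gamma>} \<subseteq> \<Delta>" "box_pow n \<psi> \<in> \<Delta>" "\<psi> \<notin> \<Delta>"
        using mcs_Loeb_successor[OF Box.prems(1)] by blast
      have sub: "shift n (pr \<Gamma>) \<subseteq> pr \<Delta>"
        unfolding pr_def
      proof (rule profile_successor)
        show "\<chi> \<in> \<Delta>" if "\<^bold>\<box> \<chi> \<in> \<Gamma>" for \<chi> using \<Delta> that by blast
        show "box_pow n \<chi> \<in> \<Delta>" if "\<^bold>\<box> \<chi> \<in> \<Gamma>" for \<chi>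
          using \<Delta>(2) mcs_theorem_Imp[OF Box.prems(1) wGL_transitivity that] by auto
      qed
      have "card (pr \<Gamma>) < card (pr \<Delta>)"
      proof (rule card_profile_less[OF n _ _ finite_boxed sub])
        show "pr \<Gamma> \<subseteq> ?B \<times> {..<n}" "pr \<Delta> \<subseteq> ?B \<times> {..<n}" by (simp_all add: pr_def profile_subset)
        show "(\<psi>, 0) \<notin> pr \<Gamma>" using False by (simp add: pr_def profile_def)
        show "(\<psi>, n - 1) \<in> pr \<Delta>"
          using \<Delta>(3) n Box.prems(2) by (cases n) (auto simp: pr_def profile_def)
      qed
      then have "R \<Gamma> \<Delta>" using \<Delta> Box.prems by (simp add: R_def)
      moreover have "\<not> sat R V \<Delta> \<psi>" using Box \<Delta> by auto
      ultimately show ?thesis using False by auto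
    qed
  qed (auto simp: V_def mcs_Falsum mcs_Imp)
  have "\<not> derives n {\<chi> \<^bold>\<rightarrow> \<^bold>\<bottom>} \<^bold>\<bottom>"
  proof
    assume "derives n {\<chi> \<^bold>\<rightarrow> \<^bold>\<bottom>} \<^bold>\<bottom>"
    then have "derives n {} ((\<chi> \<^bold>\<rightarrow> \<^bold>\<bottom>) \<^bold>\<rightarrow> \<^bold>\<bottom>)" by (rule derives_insert)
    then have "wGL\<^bsub>n\<^esub> \<turnstile> (\<chi> \<^bold>\<rightarrow> \<^bold>\<bottom>) \<^bold>\<rightarrow> \<^bold>\<bottom>" by (simp add: derives_def)
    then have "wGL\<^bsub>n\<^esub> \<turnstile> \<chi>"
      by (intro wGL_tautological_consequence[of "[(\<chi> \<^bold>\<rightarrow> \<^bold>\<bottom>) \<^bold>\<rightarrow> \<^bold>\<bottom>]"]) auto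
    then show False using unprovable by contradiction
  qed
  then obtain \<Gamma> where "(\<chi> \<^bold>\<rightarrow> \<^bold>\<bottom>) \<in> \<Gamma>" and m: "mcs n \<Gamma>" using mcs_extension by blast
  then have "\<chi> \<notin> \<Gamma>" using mcs_Imp mcs_Falsum by blast
  then have "\<not> sat R V \<Gamma> \<chi>" using truth_lemma[OF m] by blast
  then show ?thesis using fr by blast
qed

section \<open>Guarded cyclic systems\<close>

primrec unwind ::
  "('w \<Rightarrow> 'w \<Rightarrow> bool) \<Rightarrow> ('i \<Rightarrow> 'i) \<Rightarrow> ('i \<Rightarrow> 'w \<Rightarrow> bool) \<Rightarrow> ('i \<Rightarrow> 'w \<Rightarrow> bool) \<Rightarrow> nat \<Rightarrow> 'i \<Rightarrow> 'w \<Rightarrow> bool"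
  where
  "unwind R \<sigma> E D 0 i y \<longleftrightarrow> True"
| "unwind R \<sigma> E D (Suc k) i y \<longleftrightarrow>
     (\<forall>z. R y z \<longrightarrow> E i z \<or> D i z \<and> unwind R \<sigma> E D k (\<sigma> i) z)"

lemma unwind_antimono: "unwind R \<sigma> E D (Suc k) i y \<Longrightarrow> unwind R \<sigma> E D k i y"
  by (induction k arbitrary: i y) auto

text \<open>The additional innermost layer only speaks about worlds \<open>k + 1\<close> steps away, where its
  recursive demand is trivially true.\<close>

lemma unwind_extend:
  assumes "unwind R \<sigma> E D k i y"
    and "\<And>z. (R ^^ Suc k) y z \<Longrightarrow> E ((\<sigma> ^^ k) i) z \<or> D ((\<sigma> ^^ k) i) z"
  shows "unwind R \<sigma> E D (Suc k) i y"
  using assms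
proof (induction k arbitrary: i y)
  case (Suc k)
  have "E i z \<or> D i z \<and> unwind R \<sigma> E D (Suc k) (\<sigma> i) z" if z: "R y z" for z
  proof -
    have "E ((\<sigma> ^^ k) (\<sigma> i)) u \<or> D ((\<sigma> ^^ k) (\<sigma> i)) u" if "(R ^^ Suc k) z u" for u
      using Suc.prems(2)[of u] relpowp_Suc_I2[OF z that] by (simp add: funpow_swap1)
    then show ?thesis using Suc.IH[of "\<sigma> i" z] Suc.prems(1) z by auto
  qed
  then show ?case by (subst unwind.simps) blast
qed auto

text \<open>After \<open>n\<close> layers the indices have returned to \<open>i\<close>, and a world \<open>n + 1\<close> steps away is a
  successor of \<open>y\<close>, for which the outermost layer already asserts \<open>E i \<or> D i\<close>.\<close>

lemma unwind_fixed_point: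
  assumes fr: "wGL_frame n R" and n: "n \<ge> 1" and period: "(\<sigma> ^^ n) i = i"
  shows "unwind R \<sigma> E D n i y \<longleftrightarrow> (\<forall>z. R y z \<longrightarrow> E i z \<or> D i z \<and> unwind R \<sigma> E D n (\<sigma> i) z)"
proof -
  have "unwind R \<sigma> E D (Suc n) i y" if u: "unwind R \<sigma> E D n i y"
  proof (rule unwind_extend[OF u])
    fix z assume "(R ^^ Suc n) y z"
    then have "R y z" using fr by (auto simp: wGL_frame_def)
    moreover obtain m where "n = Suc m" using n by (cases n) auto
    ultimately show "E ((\<sigma> ^^ n) i) z \<or> D ((\<sigma> ^^ n) i) z" using u period by auto
  qed
  then have "unwind R \<sigma> E D n i y \<longleftrightarrow> unwind R \<sigma> E D (Suc n) i y"
    using unwind_antimono[of R \<sigma> E D n i y] by blast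
  then show ?thesis by simp
qed

lemma unwind_unique:
  assumes fr: "wGL_frame n R" and n: "n \<ge> 1"
    and I: "\<And>i. i \<in> I \<Longrightarrow> \<sigma> i \<in> I" "\<And>i. i \<in> I \<Longrightarrow> (\<sigma> ^^ n) i = i"
    and Q: "\<And>i y. i \<in> I \<Longrightarrow> Q i y \<longleftrightarrow> (\<forall>z. R y z \<longrightarrow> E i z \<or> D i z \<and> Q (\<sigma> i) z)"
    and i: "i \<in> I"
  shows "Q i y \<longleftrightarrow> unwind R \<sigma> E D n i y"
  using fr i
proof (induction y arbitrary: i rule: wGL_frame_induct)
  case (step y)
  show ?case
    using step Q[of i y] unwind_fixed_point[OF fr n I(2), of i E D y] I(1)[of i] by blast
qed

section \<open>Definable properties\<close>

type_synonym 'w property = "('w \<Rightarrow> 'w \<Rightarrow> bool) \<Rightarrow> ('w \<Rightarrow> var \<Rightarrow> bool) \<Rightarrow> 'w \<Rightarrow> bool"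

locale lyndon =
  fixes n :: nat and \<phi> :: fm and V_pos V_neg :: "var set"
  assumes n: "n \<ge> 1"
begin

text \<open>One formula has to work in all models on \<open>'w\<close>, so that it serves for every countermodel at once. The
  closure properties below allow definability to be shown without writing down formulas.\<close>

definition definable :: "'w property \<Rightarrow> bool" where
  "definable Q \<longleftrightarrow> (\<exists>\<theta>. voc_pos \<theta> \<subseteq> V_pos \<and> voc_neg \<theta> \<subseteq> V_neg \<and>
     (\<forall>R V y. wGL_frame n R \<longrightarrow> (sat R V y \<theta> \<longleftrightarrow> Q R V y)))"

lemma definable_cong:
  assumes "definable Q" "\<And>R V y. wGL_frame n R \<Longrightarrow> Q' R V y \<longleftrightarrow> Q R V y"
  shows "definable Q'"
  using assms unfolding definable_def by metis

lemma definable_const: "definable (\<lambda>R V y. c)"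
  unfolding definable_def
  by (cases c) (auto intro: exI[of _ "\<^bold>\<bottom>"] exI[of _ "\<^bold>\<bottom> \<^bold>\<rightarrow> \<^bold>\<bottom>"])

lemma definable_pos: "p \<in> V_pos \<Longrightarrow> definable (\<lambda>R V y. V y p)"
  unfolding definable_def by (rule exI[of _ "Var p"]) auto

lemma definable_neg: "p \<in> V_neg \<Longrightarrow> definable (\<lambda>R V y. \<not> V y p)"
  unfolding definable_def by (rule exI[of _ "Var p \<^bold>\<rightarrow> \<^bold>\<bottom>"]) auto

lemma definable_conj:
  assumes "definable Q" "definable Q'"
  shows "definable (\<lambda>R V y. Q R V y \<and> Q' R V y)"
proof -
  obtain \<theta> \<theta>' where
    "voc_pos \<theta> \<subseteq> V_pos \<and> voc_neg \<theta> \<subseteq> V_neg \<and> (\<forall>R V y. wGL_frame n R \<longrightarrow> (sat R V y \<theta> \<longleftrightarrow> Q R V y))"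
    "voc_pos \<theta>' \<subseteq> V_pos \<and> voc_neg \<theta>' \<subseteq> V_neg \<and> (\<forall>R V y. wGL_frame n R \<longrightarrow> (sat R V y \<theta>' \<longleftrightarrow> Q' R V y))"
    using assms unfolding definable_def by blast
  then show ?thesis
    unfolding definable_def by (intro exI[of _ "(\<theta> \<^bold>\<rightarrow> (\<theta>' \<^bold>\<rightarrow> \<^bold>\<bottom>)) \<^bold>\<rightarrow> \<^bold>\<bottom>"]) auto
qed

lemma definable_disj:
  assumes "definable Q" "definable Q'"
  shows "definable (\<lambda>R V y. Q R V y \<or> Q' R V y)"
proof -
  obtain \<theta> \<theta>' where
    "voc_pos \<theta> \<subseteq> V_pos \<and> voc_neg \<theta> \<subseteq> V_neg \<and> (\<forall>R V y. wGL_frame n R \<longrightarrow> (sat R V y \<theta> \<longleftrightarrow> Q R V y))"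
    "voc_pos \<theta>' \<subseteq> V_pos \<and> voc_neg \<theta>' \<subseteq> V_neg \<and> (\<forall>R V y. wGL_frame n R \<longrightarrow> (sat R V y \<theta>' \<longleftrightarrow> Q' R V y))"
    using assms unfolding definable_def by blast
  then show ?thesis
    unfolding definable_def by (intro exI[of _ "(\<theta> \<^bold>\<rightarrow> \<^bold>\<bottom>) \<^bold>\<rightarrow> \<theta>'"]) auto
qed

lemma definable_box:
  assumes "definable Q"
  shows "definable (\<lambda>R V y. \<forall>z. R y z \<longrightarrow> Q R V z)"
proof -
  obtain \<theta> where
    "voc_pos \<theta> \<subseteq> V_pos \<and> voc_neg \<theta> \<subseteq> V_neg \<and> (\<forall>R V y. wGL_frame n R \<longrightarrow> (sat R V y \<theta> \<longleftrightarrow> Q R V y))"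
    using assms unfolding definable_def by blast
  then show ?thesis
    unfolding definable_def by (intro exI[of _ "\<^bold>\<box> \<theta>"]) auto
qed

lemma definable_diamond:
  assumes "definable Q"
  shows "definable (\<lambda>R V y. \<exists>z. R y z \<and> Q R V z)"
proof -
  obtain \<theta> where
    "voc_pos \<theta> \<subseteq> V_pos \<and> voc_neg \<theta> \<subseteq> V_neg \<and> (\<forall>R V y. wGL_frame n R \<longrightarrow> (sat R V y \<theta> \<longleftrightarrow> Q R V y))"
    using assms unfolding definable_def by blast
  then show ?thesis
    unfolding definable_def by (intro exI[of _ "\<^bold>\<box> (\<theta> \<^bold>\<rightarrow> \<^bold>\<bottom>) \<^bold>\<rightarrow> \<^bold>\<bottom>"]) auto
qed

lemma definable_ball:
  assumes "finite S" "\<And>x. x \<in> S \<Longrightarrow> definable (Q x)"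
  shows "definable (\<lambda>R V y. \<forall>x\<in>S. Q x R V y)"
  using assms
proof (induction S)
  case empty
  then show ?case using definable_const[of True] by simp
next
  case (insert x S)
  then show ?case using definable_conj[of "Q x" "\<lambda>R V y. \<forall>x\<in>S. Q x R V y"] by simp
qed

lemma definable_bex:
  assumes "finite S" "\<And>x. x \<in> S \<Longrightarrow> definable (Q x)"
  shows "definable (\<lambda>R V y. \<exists>x\<in>S. Q x R V y)"
  using assms
proof (induction S)
  case empty
  then show ?case using definable_const[of False] by simp
next
  case (insert x S)
  then show ?case using definable_disj[of "Q x" "\<lambda>R V y. \<exists>x\<in>S. Q x R V y"] by simp
qed

section \<open>Types and the simulation relation\<close>

abbreviation atoms :: "var set" where
  "atoms \<equiv> voc_pos \<phi> \<union> voc_neg \<phi>"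

abbreviation cells :: "(fm \<times> nat) set" where
  "cells \<equiv> boxed \<phi> \<times> {..<n}"

definition types :: "(var set \<times> (fm \<times> nat) set) set" where
  "types = Pow atoms \<times> Pow cells"

text \<open>A type is an arbitrary pair of a set of true variables and a profile; the truth
  of every other subformula of \<open>\<phi>\<close> is computed from it, with the slot \<open>(\<psi>, 0)\<close> deciding \<open>\<box>\<psi>\<close>.\<close>

definition holds :: "var set \<times> (fm \<times> nat) set \<Rightarrow> fm \<Rightarrow> bool" where
  "holds t \<theta> \<longleftrightarrow> truth (\<lambda>p. p \<in> fst t) (\<lambda>\<psi>. (\<psi>, 0) \<in> snd t) \<theta>"

text \<open>The relation \<open>step\<close> is what a successor must satisfy in order not to violate the boxes in
  \<open>b\<close>; it is preserved when \<open>n + 1\<close> steps are contracted to one.\<close>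

definition step :: "(fm \<times> nat) set \<Rightarrow> var set \<times> (fm \<times> nat) set \<Rightarrow> bool" where
  "step b t \<longleftrightarrow> shift n b \<subseteq> snd t \<and> (\<forall>\<psi>. (\<psi>, 0) \<in> b \<longrightarrow> holds t \<psi>)"

definition agree :: "var set \<Rightarrow> (var \<Rightarrow> bool) \<Rightarrow> bool" where
  "agree v f \<longleftrightarrow> (\<forall>p\<in>atoms. (p \<in> V_pos \<and> p \<in> v \<longrightarrow> f p) \<and> (p \<in> V_neg \<and> p \<notin> v \<longrightarrow> \<not> f p))"

text \<open>A witness against \<open>\<box>\<psi>\<close> is moreover asked to satisfy \<open>\<box>\<^sup>n \<psi>\<close>, as Loeb's axiom permits;
  this is what makes its profile larger.\<close>

definition refutes :: "(fm \<times> nat) set \<Rightarrow> fm \<Rightarrow> var set \<times> (fm \<times> nat) set \<Rightarrow> bool" where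
  "refutes b \<psi> t \<longleftrightarrow> step b t \<and> (\<psi>, n - 1) \<in> snd t \<and> \<not> holds t \<psi>"

text \<open>On conversely well-founded frames the defining clause has only one solution, so taking the
  least one is no restriction.\<close>

inductive sim :: "('w \<Rightarrow> 'w \<Rightarrow> bool) \<Rightarrow> ('w \<Rightarrow> var \<Rightarrow> bool) \<Rightarrow>
    var set \<times> (fm \<times> nat) set \<Rightarrow> 'w \<Rightarrow> bool" for R V where
  "agree v (V y) \<Longrightarrow>
   (\<forall>\<psi>. \<psi> \<in> boxed \<phi> \<and> (\<psi>, 0) \<notin> b \<longrightarrow> (\<exists>t. t \<in> types \<and> refutes b \<psi> t \<and> (\<exists>z. R y z \<and> sim R V t z))) \<Longrightarrow>
   (\<forall>z. R y z \<longrightarrow> (\<exists>t. t \<in> types \<and> step b t \<and> sim R V t z)) \<Longrightarrow>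
   sim R V (v, b) y"

definition witnesses :: "(fm \<times> nat) set \<Rightarrow> 'w property" where
  "witnesses b R V y \<longleftrightarrow>
     (\<forall>\<psi>\<in>{\<psi> \<in> boxed \<phi>. (\<psi>, 0) \<notin> b}. \<exists>t\<in>{t \<in> types. refutes b \<psi> t}. \<exists>z. R y z \<and> sim R V t z)"

definition covers :: "(fm \<times> nat) set \<Rightarrow> 'w property" where
  "covers b R V y \<longleftrightarrow> (\<forall>z. R y z \<longrightarrow> (\<exists>t\<in>types. step b t \<and> sim R V t z))"

lemma sim_iff: "sim R V (v, b) y \<longleftrightarrow> agree v (V y) \<and> witnesses b R V y \<and> covers b R V y"
  unfolding witnesses_def covers_def by (subst sim.simps) (simp add: Bex_def)

lemma finite_atoms: "finite atoms"
proof -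
  have "finite (voc_pos \<psi>) \<and> finite (voc_neg \<psi>)" for \<psi> by (induction \<psi>) auto
  then show ?thesis by simp
qed

lemma finite_types: "finite types"
  unfolding types_def
  using finite_atoms finite_boxed by (intro finite_cartesian_product finite_Pow_iff[THEN iffD2]) auto

section \<open>The simulation relation is definable\<close>

lemma definable_agree: "definable (\<lambda>R V y. agree v (V y))"
proof -
  have pos: "definable (\<lambda>R V y. p \<in> V_pos \<and> p \<in> v \<longrightarrow> V y p)" for p
    by (cases "p \<in> V_pos \<and> p \<in> v") (use definable_pos definable_const[of True] in auto)
  have neg: "definable (\<lambda>R V y. p \<in> V_neg \<and> p \<notin> v \<longrightarrow> \<not> V y p)" for p
    by (cases "p \<in> V_neg \<and> p \<notin> v") (use definable_neg definable_const[of True] in auto)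
  show ?thesis unfolding agree_def
    by (rule definable_ball[OF finite_atoms definable_conj[OF pos neg]])
qed

text \<open>The approximations are definable one layer at a time; only the fixed point property of the
  \<open>n\<close>-th one makes them useful for a recursive condition.\<close>

lemma definable_unwind:
  assumes "\<And>i. i \<in> I \<Longrightarrow> \<sigma> i \<in> I"
    and "\<And>i. i \<in> I \<Longrightarrow> definable (\<lambda>R V. E R V i)" "\<And>i. i \<in> I \<Longrightarrow> definable (\<lambda>R V. D R V i)"
    and "i \<in> I"
  shows "definable (\<lambda>R V. unwind R \<sigma> (E R V) (D R V) k i)"
  using assms(4)
proof (induction k arbitrary: i)
  case 0
  then show ?case using definable_const[of True] by simp
next
  case (Suc k)
  show ?case
    using definable_box[OF definable_disj[OF assms(2)[OF Suc.prems]
        definable_conj[OF assms(3)[OF Suc.prems] Suc.IH[OF assms(1)[OF Suc.prems]]]]]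
    by simp
qed

text \<open>A match for a successor either has a larger profile (\<open>ascends\<close>), which the induction on
  profile size covers, or exactly the shifted profile. In the second case \<open>stays\<close> collects
  everything required except for the recursive condition \<open>covers\<close>.\<close>

definition ascends :: "(fm \<times> nat) set \<Rightarrow> 'w property" where
  "ascends b R V y \<longleftrightarrow> (\<exists>t\<in>{t \<in> types. step b t \<and> snd t \<noteq> shift n b}. sim R V t y)"

definition stays :: "(fm \<times> nat) set \<Rightarrow> 'w property" where
  "stays b R V y \<longleftrightarrow>
     (\<exists>v\<in>{v \<in> Pow atoms. step b (v, shift n b)}. agree v (V y)) \<and> witnesses (shift n b) R V y"

lemma card_refutes:
  assumes "b \<subseteq> cells" "t \<in> types" "refutes b \<psi> t" "(\<psi>, 0) \<notin> b"
  shows "card b < card (snd t)"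
proof (rule card_profile_less[OF n assms(1) _ finite_boxed _ assms(4)])
  show "snd t \<subseteq> cells" "shift n b \<subseteq> snd t" "(\<psi>, n - 1) \<in> snd t"
    using assms by (auto simp: refutes_def step_def types_def)
qed

lemma card_step:
  assumes "b \<subseteq> cells" "t \<in> types" "step b t" "snd t \<noteq> shift n b"
  shows "card b < card (snd t)"
proof -
  have "shift n b \<subset> snd t" "snd t \<subseteq> cells" using assms by (auto simp: step_def types_def)
  moreover from this(2) have "finite (snd t)" by (rule finite_subset) (simp add: finite_boxed)
  ultimately have "card (shift n b) < card (snd t)" by (simp add: psubset_card_mono)
  then show ?thesis using card_shift[OF n assms(1) finite_boxed] by simp
qed

lemma covers_equation:
  assumes "b \<subseteq> cells"
  shows "covers b R V y \<longleftrightarrow>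
    (\<forall>z. R y z \<longrightarrow> ascends b R V z \<or> stays b R V z \<and> covers (shift n b) R V z)"
proof -
  have sub: "shift n b \<subseteq> cells" using shift_subset[OF n assms] .
  have split: "(\<exists>t\<in>types. P t) \<longleftrightarrow>
      (\<exists>t\<in>types. snd t \<noteq> shift n b \<and> P t) \<or> (\<exists>v\<in>Pow atoms. P (v, shift n b))" for P
  proof
    assume "\<exists>t\<in>types. P t"
    then obtain t where t: "t \<in> types" "P t" by blast
    show "(\<exists>t\<in>types. snd t \<noteq> shift n b \<and> P t) \<or> (\<exists>v\<in>Pow atoms. P (v, shift n b))"
    proof (cases "snd t = shift n b")
      case True
      then have "P (fst t, shift n b)" using t(2) by (metis prod.collapse)
      moreover have "fst t \<in> Pow atoms" using t(1) by (auto simp: types_def)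
      ultimately show ?thesis by blast
    qed (use t in blast)
  qed (use sub in \<open>auto simp: types_def\<close>)
  have "(\<exists>t\<in>types. step b t \<and> sim R V t z) \<longleftrightarrow>
      ascends b R V z \<or> (\<exists>v\<in>Pow atoms. step b (v, shift n b) \<and> sim R V (v, shift n b) z)" for z
    unfolding ascends_def split[of "\<lambda>t. step b t \<and> sim R V t z"] by blast
  then have "(\<exists>t\<in>types. step b t \<and> sim R V t z) \<longleftrightarrow>
      ascends b R V z \<or> stays b R V z \<and> covers (shift n b) R V z" for z
    unfolding stays_def sim_iff by blast
  then show ?thesis by (simp add: covers_def)
qed

text \<open>By induction on the number of missing slots. All profiles of the same size have to be
  treated together, because shifting moves within them; \<open>I\<close> collects them. The formulas for
  \<open>witnesses\<close>, \<open>ascends\<close> and \<open>stays\<close> use only larger profiles, and \<open>covers\<close> is then the unique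
  solution of the cyclic system.\<close>

lemma definable_sim:
  assumes "t \<in> types"
  shows "definable (\<lambda>R (V :: 'w \<Rightarrow> _). sim R V t)"
  using assms
proof (induction "card cells - card (snd t)" arbitrary: t rule: less_induct)
  case less
  obtain v b where t: "t = (v, b)" by (cases t)
  define I where "I = {b' \<in> Pow cells. card b' = card b}"
  have b: "b \<in> I" using less.prems t by (auto simp: I_def types_def)
  have higher: "definable (\<lambda>R (V :: 'w \<Rightarrow> _). sim R V t')"
    if "b' \<in> I" "t' \<in> types" "card b' < card (snd t')" for b' t'
  proof (rule less.hyps[OF _ that(2)])
    have "card (snd t') \<le> card cells"
      using that(2) by (intro card_mono) (auto simp: finite_boxed types_def)
    then show "card cells - card (snd t') < card cells - card (snd t)"
      using that by (simp add: I_def t)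
  qed
  have shift_I: "shift n b' \<in> I" if "b' \<in> I" for b'
    using that card_shift[OF n _ finite_boxed, of b' \<phi>] shift_subset[OF n, of b' "boxed \<phi>"]
    by (simp add: I_def)
  have fth: "definable (witnesses b' :: 'w property)" if b': "b' \<in> I" for b'
    unfolding witnesses_def
  proof (rule definable_ball, goal_cases)
    case 1 show ?case using finite_boxed by simp
  next
    case (2 \<psi>)
    show ?case
    proof (rule definable_bex, goal_cases)
      case 1 show ?case using finite_types by simp
    next
      case (2 t')
      then have "card b' < card (snd t')"
        using \<open>\<psi> \<in> _\<close> b' card_refutes[of b' t' \<psi>] by (simp add: I_def)
      then show ?case using definable_diamond higher[OF b'] 2 by blast
    qed
  qed
  have hgh: "definable (ascends b' :: 'w property)" if b': "b' \<in> I" for b'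
    unfolding ascends_def
  proof (rule definable_bex, goal_cases)
    case 1 show ?case using finite_types by simp
  next
    case (2 t')
    then show ?case using higher[OF b', of t'] card_step[of b' t'] b' by (simp add: I_def)
  qed
  have lvl: "definable (stays b' :: 'w property)" if b': "b' \<in> I" for b'
    unfolding stays_def
    by (intro definable_conj definable_bex definable_agree fth shift_I b')
       (rule finite_subset[OF _ finite_Pow_iff[THEN iffD2, OF finite_atoms]], blast)
  have "definable (covers b :: 'w property)"
  proof (rule definable_cong)
    show "definable (\<lambda>R (V :: 'w \<Rightarrow> _). unwind R (shift n) (\<lambda>b. ascends b R V) (\<lambda>b. stays b R V) n b)"
      by (rule definable_unwind[OF shift_I hgh lvl b])
  next
    fix R :: "'w \<Rightarrow> 'w \<Rightarrow> bool" and V y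
    assume fr: "wGL_frame n R"
    show "covers b R V y \<longleftrightarrow>
        unwind R (shift n) (\<lambda>b. ascends b R V) (\<lambda>b. stays b R V) n b y"
    proof (rule unwind_unique[OF fr n shift_I _ _ b])
      show "(shift n ^^ n) b' = b'" if "b' \<in> I" for b'
        using that shift_funpow_period by (auto simp: I_def)
    qed (auto simp: I_def intro!: covers_equation)
  qed
  then show ?case
    unfolding t sim_iff by (intro definable_conj definable_agree fth b)
qed

section \<open>Every model of the formula is simulated\<close>

definition type_of :: "('w \<Rightarrow> 'w \<Rightarrow> bool) \<Rightarrow> ('w \<Rightarrow> var \<Rightarrow> bool) \<Rightarrow> 'w \<Rightarrow> var set \<times> (fm \<times> nat) set" where
  "type_of R V y = ({p \<in> atoms. V y p}, profile n (boxed \<phi>) (sat R V y))"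

lemma type_of_types: "type_of R V y \<in> types"
  using profile_subset by (auto simp: type_of_def types_def)

lemma holds_type_of:
  assumes "boxed \<theta> \<subseteq> boxed \<phi>" "voc_pos \<theta> \<union> voc_neg \<theta> \<subseteq> atoms"
  shows "holds (type_of R V y) \<theta> \<longleftrightarrow> sat R V y \<theta>"
  using assms n by (induction \<theta>) (auto simp: holds_def type_of_def profile_def)

lemma step_type_of:
  assumes fr: "wGL_frame n R" and "R y z"
  shows "step (snd (type_of R V y)) (type_of R V z)"
proof -
  have "shift n (profile n (boxed \<phi>) (sat R V y)) \<subseteq> profile n (boxed \<phi>) (sat R V z)"
    using assms wGL_frame_shortcut[OF fr] by (intro profile_successor) (auto simp: sat_box_pow)
  moreover have "holds (type_of R V z) \<psi>" if "(\<psi>, 0) \<in> profile n (boxed \<phi>) (sat R V y)" for \<psi>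
    using that assms(2) boxed_closed[of \<psi> \<phi>] by (subst holds_type_of) (auto simp: profile_def)
  ultimately show ?thesis by (simp add: step_def type_of_def)
qed

text \<open>A world is matched with its own type, and its successors with theirs. The witnesses have the
  additional property \<open>\<box>\<^sup>n \<psi>\<close> because they are chosen by \<open>Loeb_witness\<close>.\<close>

lemma sim_type_of:
  assumes fr: "wGL_frame n R"
  shows "sim R V (type_of R V y) y"
  using fr
proof (induction y rule: wGL_frame_induct)
  case (step y)
  define b where "b = snd (type_of R V y)"
  have "\<exists>t\<in>{t \<in> types. refutes b \<psi> t}. \<exists>z. R y z \<and> sim R V t z"
    if "\<psi> \<in> boxed \<phi>" "(\<psi>, 0) \<notin> b" for \<psi>
  proof -
    have "\<not> sat R V y (\<^bold>\<box> \<psi>)"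
      using that n by (auto simp: b_def type_of_def profile_def)
    then obtain z where z: "R y z" "sat R V z (box_pow n \<psi>)" "\<not> sat R V z \<psi>"
      using Loeb_witness[OF fr n] by blast
    have "box_pow n \<psi> = \<^bold>\<box> (box_pow (n - 1) \<psi>)" using n by (cases n) auto
    then have "(\<psi>, n - 1) \<in> snd (type_of R V z)"
      using z(2) n that(1) by (simp add: type_of_def profile_def)
    moreover have "\<not> holds (type_of R V z) \<psi>"
      using z(3) boxed_closed[OF that(1)] holds_type_of[of \<psi> R V z] by simp
    ultimately have "refutes b \<psi> (type_of R V z)"
      using step_type_of[OF fr z(1)] by (simp add: refutes_def b_def)
    then show ?thesis using z(1) step[OF z(1)] type_of_types[of R V z] by blast
  qed
  then have "witnesses b R V y" by (auto simp: witnesses_def)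
  moreover have "covers b R V y"
    unfolding covers_def
  proof (intro allI impI)
    fix z assume z: "R y z"
    show "\<exists>t\<in>types. step b t \<and> sim R V t z"
      by (rule bexI[of _ "type_of R V z"]) (use step[OF z] step_type_of[OF fr z] b_def type_of_types in simp_all)
  qed
  moreover have "agree (fst (type_of R V y)) (V y)" by (auto simp: agree_def type_of_def)
  ultimately have "sim R V (fst (type_of R V y), b) y" by (simp add: sim_iff)
  then show ?case by (simp add: b_def)
qed

section \<open>The model of simulating types\<close>

fun type_rel where
  "type_rel R V (t, y) (t', z) \<longleftrightarrow>
     R y z \<and> t \<in> types \<and> t' \<in> types \<and> sim R V t y \<and> sim R V t' z \<and> step (snd t) t'"

text \<open>Variables foreign to \<open>\<phi>\<close> are copied from the given model, so that the simulation respects all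
  of \<open>V_pos\<close> and \<open>V_neg\<close> and not only the variables that types record.\<close>

fun type_val where
  "type_val V (t, y) p \<longleftrightarrow> (if p \<in> atoms then p \<in> fst t else V y p)"

lemma type_rel_pow:
  assumes "(type_rel R V ^^ k) (t, y) (t', z)"
  shows "(R ^^ k) y z \<and> (shift n ^^ k) (snd t) \<subseteq> snd t'"
  using assms
proof (induction k arbitrary: t' z)
  case (Suc k)
  then obtain t'' u where u: "(type_rel R V ^^ k) (t, y) (t'', u)" "type_rel R V (t'', u) (t', z)"
    by (auto elim!: relpowp_Suc_E)
  have "shift n ((shift n ^^ k) (snd t)) \<subseteq> snd t'"
    using order_trans[OF shift_mono[of _ "snd t''" n]] Suc.IH[OF u(1)] u(2) by (simp add: step_def)
  then show ?case using Suc.IH[OF u(1)] u(2) by auto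
qed auto

text \<open>Well-foundedness is inherited from the second component. Contraction of \<open>n + 1\<close> steps holds for
  types because the first \<open>n\<close> of them shift the profile back to itself: all boxes available at the
  start are available again just before the last step.\<close>

lemma type_rel_frame:
  assumes fr: "wGL_frame n R"
  shows "wGL_frame n (type_rel R V)"
proof -
  have "wfP (R\<inverse>\<inverse>)" using fr by (simp add: wGL_frame_def)
  then have "wfP ((type_rel R V)\<inverse>\<inverse>)"
    by (rule wfp_if_convertible_to_wfp[where f = snd]) auto
  moreover have "type_rel R V x x'" if path: "(type_rel R V ^^ Suc n) x x'" for x x'
  proof -
    obtain t y t' z where x: "x = (t, y)" "x' = (t', z)" by (cases x, cases x')
    obtain t'' u where u: "(type_rel R V ^^ n) (t, y) (t'', u)" "type_rel R V (t'', u) (t', z)"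
      using path unfolding x by (auto elim!: relpowp_Suc_E)
    obtain x1 where "type_rel R V (t, y) x1"
      using path unfolding x by (meson relpowp_Suc_D2)
    then have t: "t \<in> types" "sim R V t y" by (cases x1; simp)+
    have "snd t \<subseteq> cells" using t(1) by (auto simp: types_def)
    then have "(shift n ^^ n) (snd t) = snd t" by (rule shift_funpow_period)
    then have "snd t \<subseteq> snd t''" using type_rel_pow[OF u(1)] by simp
    then have "step (snd t) t'"
      using u(2) order_trans[OF shift_mono[of "snd t" "snd t''" n]] by (auto simp: step_def)
    moreover have "R y z"
      using type_rel_pow[OF path[unfolded x]] fr by (auto simp: wGL_frame_def)
    ultimately show ?thesis using t u(2) by (simp add: x)
  qed
  ultimately show ?thesis unfolding wGL_frame_def by blast
qed

lemma type_model_truth: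
  assumes "t \<in> types" "sim R V t y" "boxed \<theta> \<subseteq> boxed \<phi>" "voc_pos \<theta> \<union> voc_neg \<theta> \<subseteq> atoms"
  shows "sat (type_rel R V) (type_val V) (t, y) \<theta> \<longleftrightarrow> holds t \<theta>"
  using assms
proof (induction \<theta> arbitrary: t y)
  case (Box \<psi>)
  show ?case
  proof (cases "(\<psi>, 0) \<in> snd t")
    case True
    then show ?thesis using Box by (auto simp: holds_def step_def)
  next
    case False
    obtain v b where t: "t = (v, b)" by (cases t)
    have "\<forall>\<psi>\<in>{\<psi> \<in> boxed \<phi>. (\<psi>, 0) \<notin> b}. \<exists>t'\<in>{t' \<in> types. refutes b \<psi> t'}. \<exists>z. R y z \<and> sim R V t' z"
      using Box.prems(2) unfolding t sim_iff witnesses_def by blast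
    moreover have "\<psi> \<in> {\<psi> \<in> boxed \<phi>. (\<psi>, 0) \<notin> b}" using False Box.prems(3) t by simp
    ultimately obtain t' z where "t' \<in> types" "refutes b \<psi> t'" "R y z" "sim R V t' z" by blast
    then have "type_rel R V (t, y) (t', z)" "\<not> sat (type_rel R V) (type_val V) (t', z) \<psi>"
      using Box by (auto simp: refutes_def t)
    then have "\<not> sat (type_rel R V) (type_val V) (t, y) (\<^bold>\<box> \<psi>)" unfolding sat.simps by blast
    then show ?thesis using False by (simp add: holds_def)
  qed
qed (auto simp: holds_def)

text \<open>Implication exchanges the two vocabularies, so the two directions are proved
  simultaneously.\<close>

lemma type_model_preserves:
  assumes "t \<in> types" "sim R V t y"
  shows "voc_pos \<psi> \<subseteq> V_pos \<Longrightarrow> voc_neg \<psi> \<subseteq> V_neg \<Longrightarrow>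
      sat (type_rel R V) (type_val V) (t, y) \<psi> \<Longrightarrow> sat R V y \<psi>"
    and "voc_pos \<psi> \<subseteq> V_neg \<Longrightarrow> voc_neg \<psi> \<subseteq> V_pos \<Longrightarrow>
      sat R V y \<psi> \<Longrightarrow> sat (type_rel R V) (type_val V) (t, y) \<psi>"
  using assms
proof (induction \<psi> arbitrary: t y)
  case (Var p)
  {
    case 1
    then show ?case by (cases t) (auto simp: sim_iff agree_def split: if_splits)
  next
    case 2
    then show ?case by (cases t) (auto simp: sim_iff agree_def split: if_splits)
  }
next
  case (Box \<psi>)
  {
    case 1
    have "sat R V z \<psi>" if z: "R y z" for z
    proof -
      have "covers (snd t) R V y" using 1(5) by (cases t) (simp add: sim_iff)
      then obtain t' where t': "t' \<in> types" "step (snd t) t'" "sim R V t' z"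
        using z unfolding covers_def by blast
      then have "type_rel R V (t, y) (t', z)" using 1(4,5) z by simp
      then have "sat (type_rel R V) (type_val V) (t', z) \<psi>" using 1(3) unfolding sat.simps by blast
      then show ?thesis using Box(1)[OF _ _ _ t'(1,3)] 1(1,2) by simp
    qed
    then show ?case by simp
  next
    case 2
    have "sat (type_rel R V) (type_val V) (t', z) \<psi>" if "type_rel R V (t, y) (t', z)" for t' z
    proof -
      have t': "t' \<in> types" "sim R V t' z" and "R y z" using that by simp_all
      then have "sat R V z \<psi>" using 2(3) by simp
      then show ?thesis using Box(2)[OF _ _ _ t'] 2(1,2) by simp
    qed
    then show ?case by simp
  }
qed auto

section \<open>Uniform interpolants\<close>

lemma interpolant_exists:
  "\<exists>\<iota>. (voc_pos \<iota> \<subseteq> V_pos \<and> voc_neg \<iota> \<subseteq> V_neg) \<and> wGL\<^bsub>n\<^esub> \<turnstile> \<phi> \<^bold>\<rightarrow> \<iota> \<and>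
     (\<forall>\<psi>. voc_pos \<psi> \<subseteq> V_pos \<and> voc_neg \<psi> \<subseteq> V_neg \<and> wGL\<^bsub>n\<^esub> \<turnstile> \<phi> \<^bold>\<rightarrow> \<psi> \<longrightarrow> wGL\<^bsub>n\<^esub> \<turnstile> \<iota> \<^bold>\<rightarrow> \<psi>)"
proof -
  have "definable (\<lambda>R V (y :: fm set). \<exists>t\<in>{t \<in> types. holds t \<phi>}. sim R V t y)"
    by (rule definable_bex) (use finite_types definable_sim in auto)
  then obtain \<iota> where voc: "voc_pos \<iota> \<subseteq> V_pos" "voc_neg \<iota> \<subseteq> V_neg"
    and \<iota>: "\<And>R V (y :: fm set). wGL_frame n R \<Longrightarrow>
      sat R V y \<iota> \<longleftrightarrow> (\<exists>t\<in>{t \<in> types. holds t \<phi>}. sim R V t y)"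
    unfolding definable_def by blast
  have "wGL\<^bsub>n\<^esub> \<turnstile> \<phi> \<^bold>\<rightarrow> \<iota>"
  proof (rule ccontr)
    assume "\<not> wGL\<^bsub>n\<^esub> \<turnstile> \<phi> \<^bold>\<rightarrow> \<iota>"
    then obtain R V and w :: "fm set"
      where fr: "wGL_frame n R" and w: "sat R V w \<phi>" "\<not> sat R V w \<iota>"
      using completeness[OF n] by fastforce
    have "holds (type_of R V w) \<phi>" using w(1) holds_type_of[of \<phi> R V w] by simp
    then have "type_of R V w \<in> {t \<in> types. holds t \<phi>}" using type_of_types by simp
    then have "sat R V w \<iota>" unfolding \<iota>[OF fr] using sim_type_of[OF fr] by (rule bexI[rotated])
    then show False using w(2) by contradiction
  qed
  moreover have "wGL\<^bsub>n\<^esub> \<turnstile> \<iota> \<^bold>\<rightarrow> \<psi>"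
    if \<psi>: "voc_pos \<psi> \<subseteq> V_pos" "voc_neg \<psi> \<subseteq> V_neg" "wGL\<^bsub>n\<^esub> \<turnstile> \<phi> \<^bold>\<rightarrow> \<psi>" for \<psi>
  proof (rule ccontr)
    assume "\<not> wGL\<^bsub>n\<^esub> \<turnstile> \<iota> \<^bold>\<rightarrow> \<psi>"
    then obtain R V and w :: "fm set"
      where fr: "wGL_frame n R" and w: "sat R V w \<iota>" "\<not> sat R V w \<psi>"
      using completeness[OF n] by fastforce
    obtain t where t: "t \<in> types" "holds t \<phi>" "sim R V t w" using w(1) unfolding \<iota>[OF fr] by blast
    have "sat (type_rel R V) (type_val V) (t, w) \<phi>"
      using type_model_truth[OF t(1,3), of \<phi>] t(2) by simp
    then have "sat (type_rel R V) (type_val V) (t, w) \<psi>"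
      using soundness[OF \<psi>(3) type_rel_frame[OF fr] n, of V "type_val V" "(t, w)"] by simp
    then have "sat R V w \<psi>" by (rule type_model_preserves(1)[OF t(1,3) \<psi>(1,2)])
    then show False using w(2) by contradiction
  qed
  ultimately show ?thesis using voc by blast
qed

end

section \<open>Uniform Lyndon interpolation\<close>

theorem mainTheorem3:
  fixes n :: nat and \<phi> :: fm and V_pos V_neg :: "var set"
  assumes "n \<ge> 1"
  shows "\<exists>\<iota>::fm.
           (voc_pos \<iota> \<subseteq> V_pos \<and> voc_neg \<iota> \<subseteq> V_neg) \<and>
           wGL\<^bsub>n\<^esub> \<turnstile> \<phi> \<^bold>\<rightarrow> \<iota> \<and>
           (\<forall>\<psi>::fm. voc_pos \<psi> \<subseteq> V_pos \<and> voc_neg \<psi> \<subseteq> V_neg \<and> wGL\<^bsub>n\<^esub> \<turnstile> \<phi> \<^bold>\<rightarrow> \<psi>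
                 \<longrightarrow> wGL\<^bsub>n\<^esub> \<turnstile> \<iota> \<^bold>\<rightarrow> \<psi>)"
proof -
  interpret lyndon n \<phi> V_pos V_neg by unfold_locales (rule assms)
  show ?thesis by (rule interpolant_exists)
qed

end
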